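(* Let $n\ge2$, $m\in\mathbb{Z}$, $\omega=2\pi m/n$, and fix the effective period $L=n/\gcd(m,n)$. For $\beta\ge0$ let $$A^\star_{ij}=\frac{e^{\beta\cos(\omega(i-j))}}{\sum_{k=0}^{n-1}e^{\beta\cos(\omega(i-k))}},\quad i,j=0,\dots,n-1,\qquad \gamma(\beta)=1-\lambda_2(A^\star).$$ (i) If $L=1$, the kernel is constant and $\gamma(\beta)=1$. (ii) If $L=2$, then $$\gamma(\beta)=1-\tanh\beta=\frac{2e^{-2\beta}}{1+e^{-2\beta}}\sim2e^{-2\beta}\quad(\beta\to\infty).$$ (iii) If $L\ge3$, let $\Delta_L=1-\cos(2\pi/L)$. As $\beta\to\infty$, $$\gamma(\beta)\sim2\Delta_L\,e^{-\beta\Delta_L}.$$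
   Context: $\lambda_2(A^\star)$ is the second largest eigenvalue (with multiplicity) of the real symmetric matrix $A^\star$. The convention $\gcd(0,n)=n$ is used. $f\sim g$ means $f/g\to1$. $A^\star$ is the consensus attention matrix of single-frequency rotary self-attention on $\mathbb{S}^1$ at integer positions $0,\dots,n-1$. *)

theory Defs
  imports
    "HOL-Analysis.Analysis"
    "HOL-Library.Landau_Symbols"
    "Jordan_Normal_Form.Char_Poly"
begin

definition rot_kernel :: "real \<Rightarrow> real \<Rightarrow> nat \<Rightarrow> nat \<Rightarrow> real" where
  "rot_kernel \<omega> \<beta> i j = exp (\<beta> * cos (\<omega> * (real i - real j)))"

definition attention_matrix :: "nat \<Rightarrow> real \<Rightarrow> real \<Rightarrow> real mat" where
  "attention_matrix n \<omega> \<beta> =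
     mat n n (\<lambda>(i, j). rot_kernel \<omega> \<beta> i j / (\<Sum>k<n. rot_kernel \<omega> \<beta> i k))"

(* The real eigenvalues in decreasing order, each repeated according to its algebraic
   multiplicity. For a real symmetric matrix these are all its eigenvalues and algebraic
   and geometric multiplicities agree. *)
definition eigenvalues_desc :: "real mat \<Rightarrow> real list" where
  "eigenvalues_desc A = rev (sorted_list_of_multiset (proots (char_poly A)))"

(* List positions count from 0. *)
definition second_eigenvalue :: "real mat \<Rightarrow> real" where
  "second_eigenvalue A = eigenvalues_desc A ! 1"

definition spectral_gap :: "nat \<Rightarrow> real \<Rightarrow> real \<Rightarrow> real" where
  "spectral_gap n \<omega> \<beta> = 1 - second_eigenvalue (attention_matrix n \<omega> \<beta>)"

(* The library gcd on int satisfies gcd 0 n = n for n >= 0, and is nonnegative for m < 0. *)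
definition effective_period :: "nat \<Rightarrow> int \<Rightarrow> nat" where
  "effective_period n m = nat (int n div gcd m (int n))"

end

theory Submission
  imports Defs "HOL-Number_Theory.Cong" "HOL-Real_Asymp.Real_Asymp"
begin

text \<open>
  The kernel depends only on the difference \<open>i - j\<close> modulo \<open>n\<close> and is even in it, so the row sums
  are all equal and the attention matrix is a symmetric circulant. Circulants are diagonalised by
  the Fourier basis; for a symmetric one the real basis \<open>cas \<theta> = cos \<theta> + sin \<theta>\<close> (the Hartley basis)
  does the same without leaving the reals, and its matrix is, up to the factor \<open>n\<close>, its own inverse.
  The eigenvalues are the normalised cosine transforms of the kernel at the frequencies
  \<open>0, \<dots>, n - 1\<close>. Frequency \<open>0\<close> gives the largest one, which is \<open>1\<close>, so the second eigenvalue is the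
  maximum over the frequencies \<open>1, \<dots>, n - 1\<close> (\<open>second_eigenvalue_attention\<close>).

  Write \<open>n = g L\<close> and \<open>m = g m'\<close> with \<open>m'\<close> coprime to \<open>L\<close>. The kernel has period \<open>L\<close>, so its transform
  vanishes at every frequency that is not a multiple of \<open>g\<close>. At the multiples, the unit \<open>m'\<close> of the
  integers modulo \<open>L\<close> can be substituted away, which leaves the transforms of
  \<open>exp (\<beta> cos (2\<pi>d/L))\<close> on the integers modulo \<open>L\<close> (\<open>mode_image\<close>). For \<open>L = 1\<close> only zeros remain,
  and for \<open>L = 2\<close> the only other value is \<open>tanh \<beta>\<close>, which is not negative for \<open>\<beta> \<ge> 0\<close>.

  For \<open>L \<ge> 3\<close>, one minus the eigenvalue at frequency \<open>k\<close> is the average of \<open>1 - cos (2\<pi>kd/L)\<close> over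
  \<open>d\<close> with weights \<open>exp (\<beta> cos (2\<pi>d/L))\<close>. At low temperature (large \<open>\<beta>\<close>) the total weight is dominated by
  \<open>d = 0\<close>, which contributes nothing to the numerator, and the numerator is dominated by the two
  nearest neighbours \<open>d = \<plusminus>1\<close>, whose relative weight is \<open>exp (- \<beta> \<Delta>)\<close>. Dropping all other terms
  bounds the gap from below, for every \<open>k\<close> at once because \<open>1 - cos (2\<pi>k/L) \<ge> \<Delta>\<close>; taking \<open>k = 1\<close>
  bounds it from above. Both bounds are asymptotic to \<open>2 \<Delta> exp (- \<beta> \<Delta>)\<close> (\<open>gap_asymp\<close>).
\<close>

section \<open>Sums over a period\<close>

lemma periodic_cong:
  fixes f :: "int \<Rightarrow> 'a"
  assumes per: "\<And>x. f (x + N) = f x" and "[x = y] (mod N)"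
  shows "f x = f y"
proof -
  have nat: "f (z + N * int q) = f z" for z q
  proof (induction q)
    case (Suc q)
    then show ?case
      using per[of "z + N * int q"] by (simp add: algebra_simps)
  qed simp
  have int: "f (z + N * q) = f z" for z q
  proof (cases "q \<ge> 0")
    case True
    then show ?thesis using nat[of z "nat q"] by simp
  next
    case False
    then show ?thesis using nat[of "z + N * q" "nat (- q)"] by simp
  qed
  from assms(2) obtain q where "y = x + N * q"
    by (auto simp: cong_iff_lin)
  then show ?thesis by (simp add: int)
qed

text \<open>Shifts, reflections and multiplication by units are the changes of variable used on the integers
  modulo \<open>N\<close>; all are affine maps with an invertible slope, so one lemma serves them all.\<close>
lemma bij_betw_affine_mod:
  fixes N c i :: int
  assumes "N > 0" "coprime c N"
  shows "bij_betw (\<lambda>d. (c * d + i) mod N) {0..<N} {0..<N}"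
proof -
  have inj: "inj_on (\<lambda>d. (c * d + i) mod N) {0..<N}"
  proof (rule inj_onI)
    fix x y assume xy: "x \<in> {0..<N}" "y \<in> {0..<N}" "(c * x + i) mod N = (c * y + i) mod N"
    then have "[c * x + i = c * y + i] (mod N)"
      by (simp add: cong_def)
    then have "[x = y] (mod N)"
      using assms(2) by (simp add: cong_add_rcancel cong_mult_lcancel)
    with xy show "x = y"
      by (auto intro: cong_less_imp_eq_int)
  qed
  moreover have "(\<lambda>d. (c * d + i) mod N) ` {0..<N} = {0..<N}"
    using assms(1) by (intro endo_inj_surj inj) auto
  ultimately show ?thesis by (simp add: bij_betw_def)
qed

lemma sum_periodic_affine:
  fixes f :: "int \<Rightarrow> 'a::comm_monoid_add"
  assumes "N > 0" "coprime c N" and per: "\<And>x. f (x + N) = f x"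
  shows "(\<Sum>d\<in>{0..<N}. f (c * d + i)) = (\<Sum>d\<in>{0..<N}. f d)"
proof -
  have "f (c * d + i) = f ((c * d + i) mod N)" for d
    by (rule periodic_cong[of f N, OF per]) (simp add: cong_def)
  then have "(\<Sum>d\<in>{0..<N}. f (c * d + i)) = (\<Sum>d\<in>{0..<N}. f ((c * d + i) mod N))"
    by simp
  also have "\<dots> = (\<Sum>d\<in>{0..<N}. f d)"
    by (rule sum.reindex_bij_betw[OF bij_betw_affine_mod]) fact+
  finally show ?thesis .
qed

text \<open>The reflection \<open>d \<mapsto> - d\<close> turns the sum into its own negative.\<close>
lemma sum_periodic_odd:
  fixes f :: "int \<Rightarrow> real"
  assumes "N > 0" "\<And>x. f (x + N) = f x" "\<And>x. f (- x) = - f x"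
  shows "(\<Sum>d\<in>{0..<N}. f d) = 0"
  using sum_periodic_affine[of N "-1" f 0] assms by (simp add: sum_negf)

lemma sum_periodic_repeat:
  fixes f :: "int \<Rightarrow> real"
  assumes "L > 0" and per: "\<And>x. f (x + L) = f x"
  shows "(\<Sum>d\<in>{0..<int g * L}. f d) = real g * (\<Sum>d\<in>{0..<L}. f d)"
proof (induction g)
  case (Suc g)
  have "{0..<q + L} = {0..<q} \<union> {q..<q + L}" if "q \<ge> 0" for q
    using that assms(1) by auto
  from this[of "int g * L"] assms(1)
  have "{0..<int (Suc g) * L} = {0..<int g * L} \<union> {int g * L..<int g * L + L}"
    by (simp add: algebra_simps)
  then have "(\<Sum>d\<in>{0..<int (Suc g) * L}. f d)
      = (\<Sum>d\<in>{0..<int g * L}. f d) + (\<Sum>d\<in>{int g * L..<int g * L + L}. f d)"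
    by (simp add: sum.union_disjoint)
  also have "(\<Sum>d\<in>{int g * L..<int g * L + L}. f d) = (\<Sum>d\<in>{0..<L}. f (d + int g * L))"
    by (rule sum.reindex_bij_witness[of _ "\<lambda>d. d + int g * L" "\<lambda>d. d - int g * L"]) auto
  also have "\<dots> = (\<Sum>d\<in>{0..<L}. f d)"
    by (intro sum.cong refl periodic_cong[of f L, OF per]) (simp add: cong_def)
  finally show ?case using Suc by (simp add: algebra_simps)
qed simp

section \<open>The cosine transform on the integers modulo N\<close>

text \<open>Indexing angles by integers makes every periodicity a congruence modulo \<open>N\<close>.\<close>
definition angle :: "int \<Rightarrow> int \<Rightarrow> real" where
  "angle N t = 2 * pi * of_int t / of_int N"

lemma angle_0 [simp]: "angle N 0 = 0"
  and angle_add: "angle N (s + t) = angle N s + angle N t"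
  and angle_diff: "angle N (s - t) = angle N s - angle N t"
  and angle_minus [simp]: "angle N (- t) = - angle N t"
  by (simp_all add: angle_def add_divide_distrib diff_divide_distrib algebra_simps)

lemma angle_scale: "g \<noteq> 0 \<Longrightarrow> angle (g * N) (g * t) = angle N t"
  by (simp add: angle_def)

lemma
  assumes "N \<noteq> 0"
  shows cos_angle_add_mult [simp]: "cos (angle N (t + q * N)) = cos (angle N t)"
    and sin_angle_add_mult [simp]: "sin (angle N (t + q * N)) = sin (angle N t)"
proof -
  have eq: "angle N (q * N) = (2 * pi) * of_int q"
    using assms by (simp add: angle_def)
  show "cos (angle N (t + q * N)) = cos (angle N t)" "sin (angle N (t + q * N)) = sin (angle N t)"
    unfolding angle_add eq cos_add sin_add by simp_all
qed

lemma cos_angle_cong: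
  assumes "N \<noteq> 0" "[s = t] (mod N)"
  shows "cos (angle N s) = cos (angle N t)"
  using assms by (auto simp: cong_iff_lin mult.commute)

lemma cos_angle_eq_1_iff:
  assumes "N \<noteq> 0"
  shows "cos (angle N t) = 1 \<longleftrightarrow> N dvd t"
proof -
  have "cos (angle N t) = 1 \<longleftrightarrow> (\<exists>q::int. real_of_int t = real_of_int (N * q))"
    using assms by (simp add: cos_one_2pi_int angle_def field_simps)
  then show ?thesis
    unfolding of_int_eq_iff by (auto simp: dvd_def)
qed

definition cos_transform :: "int \<Rightarrow> (int \<Rightarrow> real) \<Rightarrow> int \<Rightarrow> real" where
  "cos_transform N w k = (\<Sum>d\<in>{0..<N}. w d * cos (angle N (k * d)))"

lemma sin_transform_even:
  assumes "N > 0" "\<And>x. w (x + N) = w x" "\<And>x. w (- x) = w x"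
  shows "(\<Sum>d\<in>{0..<N}. w d * sin (angle N (k * d))) = 0"
  using assms by (intro sum_periodic_odd) (simp_all add: distrib_left)

text \<open>Shifting the summation variable by a period \<open>P\<close> of \<open>w\<close> multiplies the transform by
  \<open>cos (2\<pi>kP/N)\<close>, because the sine part of an even weight vanishes. If that factor is not \<open>1\<close>, the
  transform is \<open>0\<close>. With \<open>w = 1\<close> and \<open>P = 1\<close> this is the orthogonality of characters.\<close>
lemma cos_transform_eq_0:
  assumes N: "N > 0" and per: "\<And>x. w (x + N) = w x" and even: "\<And>x. w (- x) = w x"
    and P: "\<And>x. w (x + P) = w x" and "\<not> N dvd k * P"
  shows "cos_transform N w k = 0"
proof -
  have "cos_transform N w k = (\<Sum>d\<in>{0..<N}. w (1 * d + P) * cos (angle N (k * (1 * d + P))))"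
    unfolding cos_transform_def using N
    by (intro sum_periodic_affine[symmetric]) (simp_all add: per distrib_left)
  also have "\<dots> = (\<Sum>d\<in>{0..<N}. cos (angle N (k * P)) * (w d * cos (angle N (k * d)))
      - sin (angle N (k * P)) * (w d * sin (angle N (k * d))))"
    by (intro sum.cong refl) (simp add: P distrib_left angle_add cos_add algebra_simps)
  also have "\<dots> = cos (angle N (k * P)) * cos_transform N w k"
    by (simp add: sum_subtractf flip: sum_distrib_left)
      (simp add: sin_transform_even[OF N per even] cos_transform_def)
  finally show ?thesis
    using cos_angle_eq_1_iff[of N "k * P"] assms by auto
qed

lemma sum_cos_angle:
  assumes "N > 0"
  shows "(\<Sum>d\<in>{0..<N}. cos (angle N (k * d))) = (if N dvd k then of_int N else 0)"
proof (cases "N dvd k")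
  case True
  then have "cos (angle N (k * d)) = 1" for d
    using assms by (simp add: cos_angle_eq_1_iff)
  with True assms show ?thesis by simp
next
  case False
  with cos_transform_eq_0[of N "\<lambda>_. 1" 1 k] assms show ?thesis
    by (simp add: cos_transform_def)
qed

lemma cos_transform_le:
  assumes "\<And>d. w d \<ge> 0"
  shows "cos_transform N w k \<le> cos_transform N w 0"
  unfolding cos_transform_def using assms by (intro sum_mono) (simp add: mult_left_le)

section \<open>Diagonalising symmetric circulant matrices\<close>

text \<open>Hartley's kernel, the real substitute for the character \<open>exp (\<i> x)\<close>.\<close>
definition cas :: "real \<Rightarrow> real" where
  "cas x = cos x + sin x"

lemma cas_mult: "cas x * cas y = cos (x - y) + sin (x + y)"
  by (simp add: cas_def cos_diff sin_add algebra_simps)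

text \<open>In the product formula for \<open>cas\<close> the sine sums to zero by oddness, and the cosine sums to the
  orthogonality relation.\<close>
lemma sum_cas_mult:
  assumes "N > 0"
  shows "(\<Sum>d\<in>{0..<N}. cas (angle N (k * d)) * cas (angle N (l * d)))
    = (if N dvd k - l then of_int N else 0)"
proof -
  have "(\<Sum>d\<in>{0..<N}. cas (angle N (k * d)) * cas (angle N (l * d)))
    = (\<Sum>d\<in>{0..<N}. cos (angle N ((k - l) * d))) + (\<Sum>d\<in>{0..<N}. 1 * sin (angle N ((k + l) * d)))"
    by (simp add: cas_mult left_diff_distrib distrib_right angle_add angle_diff sum.distrib)
  then show ?thesis
    using sin_transform_even[of N "\<lambda>_. 1" "k + l"] assms by (simp add: sum_cos_angle)
qed

text \<open>The eigenvector equation: reversing the summation variable and expanding by the addition theorems,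
  every term with \<open>sin\<close> of the summation variable is odd and drops out.\<close>
lemma sum_circulant_cas:
  assumes N: "N > 0" and per: "\<And>x. w (x + N) = w x" and even: "\<And>x. w (- x) = w x"
  shows "(\<Sum>d\<in>{0..<N}. w (i - d) * cas (angle N (d * k)))
    = cas (angle N (i * k)) * cos_transform N w k"
proof -
  have "w (i - (x + N)) = w (i - x)" for x
    using per[of "i - (x + N)"] by simp
  then have "(\<Sum>d\<in>{0..<N}. w (i - d) * cas (angle N (d * k)))
      = (\<Sum>d\<in>{0..<N}. w (i - (- 1 * d + i)) * cas (angle N ((- 1 * d + i) * k)))"
    using N
    by (intro sum_periodic_affine[symmetric]) (simp_all add: distrib_right cas_def mult.commute[of N])
  also have "\<dots> = (\<Sum>d\<in>{0..<N}. cas (angle N (i * k)) * (w d * cos (angle N (k * d)))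
      + (sin (angle N (i * k)) - cos (angle N (i * k))) * (w d * sin (angle N (k * d))))"
    by (intro sum.cong refl)
      (simp add: cas_def left_diff_distrib angle_diff cos_diff sin_diff algebra_simps)
  also have "\<dots> = cas (angle N (i * k)) * cos_transform N w k"
    by (simp add: sum.distrib flip: sum_distrib_left)
      (simp add: sin_transform_even[OF N per even] cos_transform_def)
  finally show ?thesis .
qed

lemma sum_int_interval: "(\<Sum>d\<in>{0..<n}. f (int d)) = (\<Sum>d\<in>{0..<int n}. f d)"
  by (rule sum.reindex_bij_witness[of _ nat int]) auto

text \<open>The Hartley matrix \<open>H\<close> conjugates the circulant to a diagonal matrix, with inverse \<open>H / n\<close>; similar
  matrices have the same characteristic polynomial, so multiplicities come for free.\<close>
lemma char_poly_circulant:
  assumes n: "n > 0" and per: "\<And>x. w (x + int n) = w x" and even: "\<And>x. w (- x) = w x"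
  shows "char_poly (mat n n (\<lambda>(i, j). w (int i - int j)))
    = (\<Prod>a\<leftarrow>map (\<lambda>k. cos_transform (int n) w (int k)) [0..<n]. [:- a, 1:])"
proof -
  define C where "C = mat n n (\<lambda>(i, j). w (int i - int j))"
  define H where "H = mat n n (\<lambda>(i, j). cas (angle (int n) (int i * int j)))"
  define D where "D = mat n n (\<lambda>(i, j). if i = j then cos_transform (int n) w (int i) else 0)"
  have carrier: "C \<in> carrier_mat n n" "H \<in> carrier_mat n n" "D \<in> carrier_mat n n"
    by (auto simp: C_def H_def D_def)
  have HH: "H * H = real n \<cdot>\<^sub>m 1\<^sub>m n"
  proof (rule eq_matI)
    fix i j assume ij: "i < dim_row (real n \<cdot>\<^sub>m 1\<^sub>m n)" "j < dim_col (real n \<cdot>\<^sub>m 1\<^sub>m n)"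
    then have "(H * H) $$ (i, j) = (\<Sum>d\<in>{0..<n}. cas (angle (int n) (int i * int d)) *
        cas (angle (int n) (int j * int d)))"
      by (simp add: H_def scalar_prod_def mult.commute)
    also have "\<dots> = (if int n dvd int i - int j then of_int (int n) else 0)"
      using sum_cas_mult[of "int n" "int i" "int j"] n
      by (subst sum_int_interval[where f = "\<lambda>d. cas (angle (int n) (int i * d)) *
        cas (angle (int n) (int j * d))"]) simp
    also have "int n dvd int i - int j \<longleftrightarrow> i = j"
      using ij by (auto simp: mod_eq_dvd_iff[symmetric])
    finally show "(H * H) $$ (i, j) = (real n \<cdot>\<^sub>m 1\<^sub>m n) $$ (i, j)"
      using ij by simp
  qed (auto simp: H_def)
  have CH: "C * H = H * D"
  proof (rule eq_matI)
    fix i k assume ik: "i < dim_row (H * D)" "k < dim_col (H * D)"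
    then have ik': "i < n" "k < n" by (auto simp: H_def D_def)
    then have "(C * H) $$ (i, k)
        = (\<Sum>d\<in>{0..<n}. w (int i - int d) * cas (angle (int n) (int d * int k)))"
      by (simp add: C_def H_def scalar_prod_def)
    also have "\<dots> = cas (angle (int n) (int i * int k)) * cos_transform (int n) w (int k)"
      using sum_circulant_cas[of "int n" w "int i" "int k"] n per even
      by (subst sum_int_interval[where f = "\<lambda>d. w (int i - d) * cas (angle (int n) (d * int k))"]) simp
    also have "\<dots> = (H * D) $$ (i, k)"
      using ik' by (simp add: H_def D_def scalar_prod_def if_distrib cong: if_cong)
    finally show "(C * H) $$ (i, k) = (H * D) $$ (i, k)" .
  qed (auto simp: H_def C_def D_def)
  let ?Q = "(1 / real n) \<cdot>\<^sub>m H"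
  have HQ: "H * ?Q = 1\<^sub>m n" "?Q * H = 1\<^sub>m n"
    using n HH carrier(2) by (auto simp: mult_smult_distrib[of _ n n] mult_smult_assoc_mat[of _ n n])
  have "C = C * (H * ?Q)" using carrier HQ by simp
  also have "\<dots> = H * D * ?Q"
    using carrier by (subst CH[symmetric], intro assoc_mult_mat[symmetric]) auto
  finally have "similar_mat C D"
    using carrier HQ by (intro similar_matI[of _ _ H ?Q n]) auto
  then have "char_poly C = char_poly D" by (rule char_poly_similar)
  also have "\<dots> = (\<Prod>a\<leftarrow>diag_mat D. [:- a, 1:])"
    using carrier by (intro char_poly_upper_triangular) (auto simp: upper_triangular_def D_def)
  also have "diag_mat D = map (\<lambda>k. cos_transform (int n) w (int k)) [0..<n]"
    by (auto simp: diag_mat_def D_def)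
  finally show ?thesis by (simp add: C_def)
qed

lemma proots_linear_factors: "proots (\<Prod>a\<leftarrow>as. [:- a, 1:]) = mset (as :: real list)"
proof (induction as)
  case (Cons a as)
  have "(\<Prod>a\<leftarrow>as. [:- a, 1:]) \<noteq> (0 :: real poly)"
    by (auto simp: prod_list_zero_iff)
  with Cons show ?case by (simp add: proots_mult del: mult_pCons_left)
qed simp

text \<open>Removing one copy of a largest root leaves the second one as the maximum of the rest, also when
  the largest root is repeated.\<close>
lemma second_eigenvalue_eq_Max:
  assumes "proots (char_poly A) = mset (a # as)" "as \<noteq> []" "\<And>x. x \<in> set as \<Longrightarrow> x \<le> a"
  shows "second_eigenvalue A = Max (set as)"
proof -
  have "eigenvalues_desc A = a # rev (sort as)"
    unfolding eigenvalues_desc_def assms(1) using assms(3)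
    by (simp add: sorted_list_of_multiset_mset sorted_insort_is_snoc)
  moreover have nonempty: "sort as \<noteq> []"
    using assms(2) by (metis set_empty set_sort)
  ultimately have "second_eigenvalue A = last (sort as)"
    using hd_conv_nth[of "rev (sort as)"] by (simp add: second_eigenvalue_def hd_rev)
  also have "\<dots> = Max (set as)"
  proof (rule Max_eqI[symmetric])
    show "last (sort as) \<in> set as"
      using nonempty last_in_set[of "sort as"] by simp
    fix x assume "x \<in> set as"
    then obtain i where i: "i < length (sort as)" "x = sort as ! i"
      by (metis in_set_conv_nth set_sort)
    then show "x \<le> last (sort as)"
      using nonempty by (subst last_conv_nth) (auto intro!: sorted_nth_mono)
  qed simp
  finally show ?thesis .
qed

section \<open>The spectrum of the attention matrix\<close>

definition kernel_weight :: "int \<Rightarrow> int \<Rightarrow> real \<Rightarrow> int \<Rightarrow> real" where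
  "kernel_weight N m \<beta> d = exp (\<beta> * cos (angle N (m * d)))"

text \<open>The transform at frequency \<open>0\<close> is the common row sum of the kernel, so this is the eigenvalue of
  the row-normalised kernel at frequency \<open>k\<close>.\<close>
definition mode_eigenvalue :: "int \<Rightarrow> int \<Rightarrow> real \<Rightarrow> int \<Rightarrow> real" where
  "mode_eigenvalue N m \<beta> k = cos_transform N (kernel_weight N m \<beta>) k / cos_transform N (kernel_weight N m \<beta>) 0"

lemma kernel_weight_pos: "kernel_weight N m \<beta> d > 0"
  by (simp add: kernel_weight_def)

lemma kernel_weight_minus: "kernel_weight N m \<beta> (- d) = kernel_weight N m \<beta> d"
  by (simp add: kernel_weight_def)

lemma kernel_weight_periodic: "N \<noteq> 0 \<Longrightarrow> kernel_weight N m \<beta> (d + N) = kernel_weight N m \<beta> d"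
  by (simp add: kernel_weight_def distrib_left)

lemma cos_transform_0_pos:
  "N > 0 \<Longrightarrow> cos_transform N (kernel_weight N m \<beta>) 0 > 0"
  unfolding cos_transform_def by (intro sum_pos) (auto simp: kernel_weight_pos)

lemma mode_cong: "N \<noteq> 0 \<Longrightarrow> [k = l] (mod N) \<Longrightarrow> mode_eigenvalue N m \<beta> k = mode_eigenvalue N m \<beta> l"
  unfolding mode_eigenvalue_def cos_transform_def
  by (intro arg_cong2[where f = "(/)"] sum.cong arg_cong2[where f = "(*)"] cos_angle_cong refl)
    (simp_all add: cong_scalar_right)

lemma second_eigenvalue_attention:
  assumes n: "n \<ge> 2"
  shows "second_eigenvalue (attention_matrix n (2 * pi * real_of_int m / real n) \<beta>)
    = Max (mode_eigenvalue (int n) m \<beta> ` {1..<int n})"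
proof -
  let ?w = "kernel_weight (int n) m \<beta>"
  let ?A = "attention_matrix n (2 * pi * real_of_int m / real n) \<beta>"
  define Z where "Z = cos_transform (int n) ?w 0"
  have Z: "Z > 0" using n by (simp add: Z_def cos_transform_0_pos)
  have w: "rot_kernel (2 * pi * real_of_int m / real n) \<beta> i j = ?w (int i - int j)" for i j
    by (simp add: rot_kernel_def kernel_weight_def angle_def mult.assoc)
  have row: "(\<Sum>j<n. ?w (int i - int j)) = Z" for i
  proof -
    have "(\<Sum>j<n. ?w (int i - int j)) = (\<Sum>d\<in>{0..<int n}. ?w (- 1 * d + int i))"
      using sum_int_interval[of "\<lambda>d. ?w (int i - d)" n] by (simp add: lessThan_atLeast0)
    also have "\<dots> = (\<Sum>d\<in>{0..<int n}. ?w d)"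
      using n by (intro sum_periodic_affine) (simp_all add: kernel_weight_periodic)
    finally show ?thesis by (simp add: Z_def cos_transform_def)
  qed
  have "?A = mat n n (\<lambda>(i, j). ?w (int i - int j) / Z)"
    by (simp add: attention_matrix_def w row)
  moreover have "cos_transform (int n) (\<lambda>d. ?w d / Z) k = mode_eigenvalue (int n) m \<beta> k" for k
    by (simp add: mode_eigenvalue_def Z_def) (simp add: cos_transform_def sum_divide_distrib)
  ultimately have "char_poly ?A = (\<Prod>a\<leftarrow>map (\<lambda>k. mode_eigenvalue (int n) m \<beta> (int k)) [0..<n]. [:- a, 1:])"
    using char_poly_circulant[of n "\<lambda>d. ?w d / Z"] n
    by (simp add: kernel_weight_periodic kernel_weight_minus)
  then have proots: "proots (char_poly ?A)
      = mset (mode_eigenvalue (int n) m \<beta> 0 # map (\<lambda>k. mode_eigenvalue (int n) m \<beta> (int k)) [1..<n])"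
    using n by (simp only: proots_linear_factors) (simp add: upt_conv_Cons)
  have le: "mode_eigenvalue (int n) m \<beta> k \<le> mode_eigenvalue (int n) m \<beta> 0" for k
    using Z cos_transform_le[of ?w "int n" k] unfolding mode_eigenvalue_def Z_def
    by (intro divide_right_mono) (auto simp: kernel_weight_pos less_imp_le)
  have "int ` {1..<n} = {1..<int n}"
    by (simp add: image_int_atLeastLessThan)
  then have "set (map (\<lambda>k. mode_eigenvalue (int n) m \<beta> (int k)) [1..<n]) = mode_eigenvalue (int n) m \<beta> ` {1..<int n}"
    by (simp flip: image_image)
  with second_eigenvalue_eq_Max[OF proots] n le show ?thesis by auto
qed

text \<open>The kernel repeats after \<open>L\<close> positions, which only the frequencies divisible by \<open>g\<close> can see.\<close>
lemma mode_eq_0: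
  assumes "g > 0" "L > 0" "\<not> g dvd k"
  shows "mode_eigenvalue (g * L) (g * m) \<beta> k = 0"
proof -
  have "g * m * (d + L) = g * m * d + m * (g * L)" for d
    by (simp add: algebra_simps)
  then have "kernel_weight (g * L) (g * m) \<beta> (d + L) = kernel_weight (g * L) (g * m) \<beta> d" for d
    using assms unfolding kernel_weight_def by (metis cos_angle_add_mult mult_eq_0_iff order_less_irrefl)
  then have "cos_transform (g * L) (kernel_weight (g * L) (g * m) \<beta>) k = 0"
    using assms
    by (intro cos_transform_eq_0[where P = L]) (simp_all add: kernel_weight_periodic kernel_weight_minus)
  then show ?thesis by (simp add: mode_eigenvalue_def)
qed

text \<open>The sum over \<open>g L\<close> positions runs \<open>g\<close> times through a period of length \<open>L\<close>, and the factor \<open>g\<close>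
  cancels in the normalisation. The frequency is written as \<open>g m k\<close> so that the summation variable
  occurs only through \<open>m d\<close>, and the unit \<open>m\<close> disappears by substitution.\<close>
lemma mode_reduce:
  assumes "g > 0" "L > 0" "coprime m L"
  shows "mode_eigenvalue (int g * L) (int g * m) \<beta> (int g * (m * k)) = mode_eigenvalue L 1 \<beta> k"
proof -
  have "cos_transform (int g * L) (kernel_weight (int g * L) (int g * m) \<beta>) (int g * (m * k))
      = real g * cos_transform L (kernel_weight L 1 \<beta>) k" for k
  proof -
    define F where "F x = exp (\<beta> * cos (angle L x)) * cos (angle L (k * x))" for x
    have F: "F (x + q * L) = F x" for x q
      using assms(2) by (simp add: F_def distrib_left mult.assoc[symmetric])
    have F1: "F (x + L) = F x" for x using F[of x 1] by simp
    have "cos_transform (int g * L) (kernel_weight (int g * L) (int g * m) \<beta>) (int g * (m * k))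
        = (\<Sum>d\<in>{0..<int g * L}. F (m * d + 0))"
    proof -
      have "int g * m * d = int g * (m * d)" "int g * (m * k) * d = int g * (k * (m * d))" for d
        by (simp_all add: mult_ac)
      with assms(1) show ?thesis
        by (simp only: cos_transform_def kernel_weight_def F_def angle_scale) (simp add: angle_scale)
    qed
    also have "\<dots> = real g * (\<Sum>d\<in>{0..<L}. F (m * d + 0))"
      using assms(2) F by (intro sum_periodic_repeat) (simp_all add: distrib_left)
    also have "(\<Sum>d\<in>{0..<L}. F (m * d + 0)) = (\<Sum>d\<in>{0..<L}. F d)"
      using assms F1 by (intro sum_periodic_affine)
    finally show ?thesis by (simp add: F_def cos_transform_def kernel_weight_def)
  qed
  from this[of k] this[of 0] assms(1) show ?thesis by (simp add: mode_eigenvalue_def)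
qed

text \<open>Multiplication by the unit \<open>m\<close> permutes the nonzero residues modulo \<open>L\<close>, so the multiples of \<open>g\<close>
  give exactly the nontrivial modes of the reduced problem. Other frequencies exist only if \<open>g > 1\<close>.\<close>
lemma mode_image:
  assumes g: "g > 0" and L: "L > 0" and m: "coprime m L"
  shows "mode_eigenvalue (int g * L) (int g * m) \<beta> ` {1..<int g * L}
    = mode_eigenvalue L 1 \<beta> ` {1..<L} \<union> (if g = 1 then {} else {0})" (is "?f ` _ = ?h ` _ \<union> ?Z")
proof -
  have reduce: "?f (int g * l) = ?h k" if "l = (m * k) mod L" for k l
  proof -
    have "m * k = l + L * (m * k div L)"
      using that by simp
    then have "int g * (m * k) = int g * l + int g * L * (m * k div L)"
      by (metis distrib_left mult.assoc)
    then have "[int g * l = int g * (m * k)] (mod (int g * L))"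
      unfolding cong_iff_lin by blast
    then have "?f (int g * l) = ?f (int g * (m * k))"
      using g L by (intro mode_cong) auto
    then show ?thesis using mode_reduce[OF g L m] by simp
  qed
  have bij: "bij_betw (\<lambda>k. (m * k + 0) mod L) {0..<L} {0..<L}"
    using L m by (rule bij_betw_affine_mod)
  show ?thesis
  proof (intro equalityI subsetI)
    fix x assume "x \<in> ?f ` {1..<int g * L}"
    then obtain k where k: "1 \<le> k" "k < int g * L" "x = ?f k" by auto
    show "x \<in> ?h ` {1..<L} \<union> ?Z"
    proof (cases "int g dvd k")
      case True
      then obtain l where l: "k = int g * l" by auto
      have "0 < int g * l" using k l by linarith
      then have "0 < l" using g by (simp add: zero_less_mult_iff)
      have "l < L" using k l g by simp
      with \<open>0 < l\<close> have "l \<in> (\<lambda>k. (m * k + 0) mod L) ` {0..<L}"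
        using bij by (simp add: bij_betw_def)
      then obtain j where j: "j \<in> {0..<L}" "l = (m * j) mod L"
        by (metis (no_types, lifting) add_0_right imageE)
      then have "j \<noteq> 0" using \<open>0 < l\<close> by (intro notI) simp
      then have "j \<in> {1..<L}" using j(1) by simp
      moreover have "x = ?h j" using reduce[OF j(2)] k(3) l by simp
      ultimately show ?thesis by blast
    next
      case False
      with mode_eq_0[of "int g" L k m \<beta>] g L k show ?thesis by auto
    qed
  next
    fix x assume "x \<in> ?h ` {1..<L} \<union> ?Z"
    then consider k where "1 \<le> k" "k < L" "x = ?h k" | "g \<noteq> 1" "x = 0"
      by (auto split: if_splits)
    then show "x \<in> ?f ` {1..<int g * L}"
    proof cases
      case 1
      define l where "l = (m * k) mod L"
      have "\<not> L dvd m * k"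
      proof
        assume "L dvd m * k"
        then have "L dvd k"
          using m by (metis coprime_commute coprime_dvd_mult_right_iff)
        with 1 show False using zdvd_imp_le[of L k] by simp
      qed
      then have "l \<noteq> 0" by (simp add: l_def dvd_eq_mod_eq_0)
      moreover have "0 \<le> l" "l < L" using L by (simp_all add: l_def)
      ultimately have "0 < int g * l" "int g * l < int g * L" using g by simp_all
      then have "int g * l \<in> {1..<int g * L}" by simp
      moreover have "x = ?f (int g * l)" using reduce[of l k] 1 by (simp add: l_def)
      ultimately show ?thesis by blast
    next
      case 2
      have "2 * 1 \<le> int g * L" using 2 g L by (intro mult_mono) auto
      then have "1 \<in> {1..<int g * L}" by simp
      moreover have "?f 1 = 0" using 2 g L by (intro mode_eq_0) auto
      ultimately show ?thesis using 2 by (metis image_eqI)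
    qed
  qed
qed

section \<open>The gap at low temperature\<close>

text \<open>On the circle of \<open>L\<close> points, the two neighbours of the origin are the closest points to it. By the
  symmetry \<open>d \<mapsto> L - d\<close> only the first half circle matters, where the cosine decreases.\<close>
lemma cos_angle_le:
  assumes "1 \<le> d" "d < L"
  shows "cos (angle L d) \<le> cos (angle L 1)"
    and "\<lbrakk>d \<noteq> 1; d \<noteq> L - 1\<rbrakk> \<Longrightarrow> cos (angle L d) < cos (angle L 1)"
proof -
  have half: "cos (angle L e) \<le> cos (angle L 1) \<and> (e \<noteq> 1 \<longrightarrow> cos (angle L e) < cos (angle L 1))"
    if e: "1 \<le> e" "2 * e \<le> L" for e
  proof -
    have "angle L e \<le> pi" "0 \<le> angle L 1" using e
      by (auto simp: angle_def divide_simps)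
    moreover have "angle L 1 < angle L e" if "e \<noteq> 1"
      using that e by (auto simp: angle_def divide_simps)
    ultimately show ?thesis
      using cos_monotone_0_pi[of "angle L 1" "angle L e"] by (cases "e = 1") auto
  qed
  have "cos (angle L d) = cos (angle L (- d + 1 * L))"
    using assms by (subst cos_angle_add_mult) auto
  with half[of d] half[of "L - d"] assms
  show "cos (angle L d) \<le> cos (angle L 1)"
    and "\<lbrakk>d \<noteq> 1; d \<noteq> L - 1\<rbrakk> \<Longrightarrow> cos (angle L d) < cos (angle L 1)"
    by (cases "2 * d \<le> L"; force)+
qed

lemma tendsto_exp_mult_at_top:
  fixes c :: real
  assumes "c \<le> 0"
  shows "((\<lambda>\<beta>. exp (\<beta> * c)) \<longlongrightarrow> (if c = 0 then 1 else 0)) at_top"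
proof (cases "c = 0")
  case False
  with assms have "c < 0" by simp
  then have "((\<lambda>\<beta>. exp (\<beta> * c)) \<longlongrightarrow> 0) at_top" by real_asymp
  with False show ?thesis by simp
qed simp

lemma one_minus_mode:
  assumes "L > 0"
  shows "1 - mode_eigenvalue L 1 \<beta> k
    = (\<Sum>d\<in>{0..<L}. exp (\<beta> * cos (angle L d)) * (1 - cos (angle L (k * d))))
      / (\<Sum>d\<in>{0..<L}. exp (\<beta> * cos (angle L d)))"
proof -
  have "(\<Sum>d\<in>{0..<L}. exp (\<beta> * cos (angle L d))) > 0"
    using assms by (intro sum_pos) auto
  then show ?thesis
    by (simp add: mode_eigenvalue_def cos_transform_def kernel_weight_def right_diff_distrib sum_subtractf
        diff_divide_distrib)
qed

text \<open>All summands in \<open>one_minus_mode\<close> are nonnegative, so it suffices to keep the positions \<open>1\<close> and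
  \<open>L - 1\<close>. They are distinct because \<open>L \<ge> 3\<close>.\<close>
lemma one_minus_mode_ge:
  assumes L: "L \<ge> 3" and k: "1 \<le> k" "k < L"
  shows "2 * (1 - cos (angle L 1)) * exp (\<beta> * cos (angle L 1))
      / (\<Sum>d\<in>{0..<L}. exp (\<beta> * cos (angle L d))) \<le> 1 - mode_eigenvalue L 1 \<beta> k"
proof -
  have "cos (angle L (L - 1)) = cos (angle L 1)"
    using L cos_angle_add_mult[of L "- 1" 1] by simp
  moreover have "cos (angle L (k * (L - 1))) = cos (angle L k)"
    using L cos_angle_add_mult[of L "- k" k] by (simp add: right_diff_distrib)
  ultimately have pair: "(\<Sum>d\<in>{1, L - 1}. exp (\<beta> * cos (angle L d)) * (1 - cos (angle L (k * d))))
      = 2 * (1 - cos (angle L k)) * exp (\<beta> * cos (angle L 1))"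
    using L by simp
  have "2 * (1 - cos (angle L 1)) * exp (\<beta> * cos (angle L 1))
      \<le> 2 * (1 - cos (angle L k)) * exp (\<beta> * cos (angle L 1))"
    using cos_angle_le(1)[OF k] by (intro mult_right_mono) auto
  also have "\<dots> \<le> (\<Sum>d\<in>{0..<L}. exp (\<beta> * cos (angle L d)) * (1 - cos (angle L (k * d))))"
    unfolding pair[symmetric] using L by (intro sum_mono2) auto
  finally show ?thesis
    using L by (subst one_minus_mode) (auto intro!: divide_right_mono sum_nonneg)
qed

text \<open>After division by \<open>exp \<beta>\<close> only the term \<open>d = 0\<close> survives.\<close>
lemma partition_sum_asymp:
  assumes L: "L > 0"
  shows "((\<lambda>\<beta>. exp \<beta> / (\<Sum>d\<in>{0..<L}. exp (\<beta> * cos (angle L d)))) \<longlongrightarrow> 1) at_top"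
proof -
  have lim: "((\<lambda>\<beta>. \<Sum>d\<in>{0..<L}. exp (\<beta> * (cos (angle L d) - 1)))
      \<longlongrightarrow> (\<Sum>d\<in>{0..<L}. if cos (angle L d) - 1 = 0 then 1 else 0)) at_top"
    by (intro tendsto_sum tendsto_exp_mult_at_top) simp
  have "L dvd d \<longleftrightarrow> d = 0" if "d \<in> {0..<L}" for d
    using that zdvd_imp_le[of L d] by fastforce
  then have "(\<Sum>d\<in>{0..<L}. if cos (angle L d) - 1 = 0 then 1 else 0) = (\<Sum>d\<in>{0..<L}. if d = 0 then 1 else (0::real))"
    using L by (intro sum.cong) (simp_all add: cos_angle_eq_1_iff)
  also have "\<dots> = 1" using L by simp
  finally have "((\<lambda>\<beta>. inverse (\<Sum>d\<in>{0..<L}. exp (\<beta> * (cos (angle L d) - 1)))) \<longlongrightarrow> inverse 1) at_top"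
    using lim by (intro tendsto_inverse) auto
  moreover have "inverse (\<Sum>d\<in>{0..<L}. exp (\<beta> * (cos (angle L d) - 1)))
      = exp \<beta> / (\<Sum>d\<in>{0..<L}. exp (\<beta> * cos (angle L d)))" for \<beta>
    by (simp add: right_diff_distrib exp_diff flip: sum_divide_distrib)
  ultimately show ?thesis by simp
qed

text \<open>After division by the weight of a nearest neighbour, the term \<open>d = 0\<close> explodes but carries the
  factor \<open>1 - cos 0 = 0\<close>, the two neighbours are constant, and everything else decays.\<close>
lemma leading_terms_asymp:
  assumes L: "L \<ge> 3"
  shows "((\<lambda>\<beta>. \<Sum>d\<in>{0..<L}. exp (\<beta> * (cos (angle L d) - cos (angle L 1))) * (1 - cos (angle L d)))
    \<longlongrightarrow> 2 * (1 - cos (angle L 1))) at_top"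
proof -
  let ?c = "cos (angle L 1)"
  have sym: "cos (angle L (L - 1)) = ?c"
    using L cos_angle_add_mult[of L "- 1" 1] by simp
  have "((\<lambda>\<beta>. exp (\<beta> * (cos (angle L d) - ?c)) * (1 - cos (angle L d)))
      \<longlongrightarrow> (if d \<in> {1, L - 1} then 1 - ?c else 0)) at_top" if d: "d \<in> {0..<L}" for d
  proof (cases "d = 0")
    case False
    with d have d': "1 \<le> d" "d < L" by auto
    have "((\<lambda>\<beta>. exp (\<beta> * (cos (angle L d) - ?c)) * (1 - cos (angle L d)))
      \<longlongrightarrow> (if cos (angle L d) - ?c = 0 then 1 else 0) * (1 - cos (angle L d))) at_top"
      using cos_angle_le(1)[OF d'] by (intro tendsto_mult_right tendsto_exp_mult_at_top) simp
    moreover have "cos (angle L d) - ?c = 0 \<longleftrightarrow> d \<in> {1, L - 1}"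
      using cos_angle_le(2)[OF d'] sym by force
    ultimately show ?thesis by (auto split: if_splits)
  qed (use L in auto)
  then have "((\<lambda>\<beta>. \<Sum>d\<in>{0..<L}. exp (\<beta> * (cos (angle L d) - ?c)) * (1 - cos (angle L d)))
      \<longlongrightarrow> (\<Sum>d\<in>{0..<L}. if d \<in> {1, L - 1} then 1 - ?c else 0)) at_top"
    by (rule tendsto_sum)
  also have "(\<Sum>d\<in>{0..<L}. if d \<in> {1, L - 1} then 1 - ?c else 0) = (\<Sum>d\<in>{1, L - 1}. 1 - ?c)"
    using L by (intro sum.mono_neutral_cong_right) auto
  also have "\<dots> = 2 * (1 - ?c)" using L by simp
  finally show ?thesis .
qed

text \<open>The set \<open>Z\<close> holds the eigenvalue \<open>0\<close> that is present when \<open>g > 1\<close>. It cannot be the maximum for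
  large \<open>\<beta>\<close>, since the lower bound \<open>l\<close> for the gap tends to \<open>0\<close> and is therefore eventually below \<open>1\<close>.\<close>
lemma gap_asymp:
  assumes L: "L \<ge> 3" and Z: "Z \<subseteq> {0}"
  shows "(\<lambda>\<beta>. 1 - Max (mode_eigenvalue L 1 \<beta> ` {1..<L} \<union> Z))
    \<sim>[at_top] (\<lambda>\<beta>. 2 * (1 - cos (angle L 1)) * exp (- \<beta> * (1 - cos (angle L 1))))"
    (is "?\<gamma> \<sim>[at_top] ?a")
proof -
  define \<Delta> where "\<Delta> = 1 - cos (angle L 1)"
  define S where "S \<beta> = (\<Sum>d\<in>{0..<L}. exp (\<beta> * cos (angle L d)))" for \<beta>
  define l where "l \<beta> = 2 * \<Delta> * exp (\<beta> * cos (angle L 1)) / S \<beta>" for \<beta>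
  define u where "u \<beta> = 1 - mode_eigenvalue L 1 \<beta> 1" for \<beta>
  have "cos (angle L 1) \<noteq> 1"
    using L zdvd_imp_le[of L 1] by (subst cos_angle_eq_1_iff) auto
  then have \<Delta>: "\<Delta> > 0"
    using cos_le_one[of "angle L 1"] unfolding \<Delta>_def by linarith
  have a: "?a \<beta> = 2 * \<Delta> * exp (\<beta> * cos (angle L 1)) / exp \<beta>" for \<beta>
    by (simp add: \<Delta>_def algebra_simps exp_diff exp_add exp_minus field_simps)
  have S: "((\<lambda>\<beta>. exp \<beta> / S \<beta>) \<longlongrightarrow> 1) at_top"
    unfolding S_def using L by (intro partition_sum_asymp) simp
  have l: "l \<sim>[at_top] ?a"
  proof (rule asymp_equivI')
    have "l \<beta> / ?a \<beta> = exp \<beta> / S \<beta>" for \<beta>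
      unfolding a l_def using \<Delta> by simp
    with S show "((\<lambda>\<beta>. l \<beta> / ?a \<beta>) \<longlongrightarrow> 1) at_top" by simp
  qed
  have u: "u \<sim>[at_top] ?a"
  proof (rule asymp_equivI')
    let ?T = "\<lambda>\<beta>. \<Sum>d\<in>{0..<L}. exp (\<beta> * (cos (angle L d) - cos (angle L 1))) * (1 - cos (angle L d))"
    have "?T \<beta> = (\<Sum>d\<in>{0..<L}. exp (\<beta> * cos (angle L d)) * (1 - cos (angle L d)))
        / exp (\<beta> * cos (angle L 1))" for \<beta>
      by (simp add: right_diff_distrib[of \<beta>] exp_diff sum_divide_distrib)
    then have "u \<beta> / ?a \<beta> = ?T \<beta> / (2 * \<Delta>) * (exp \<beta> / S \<beta>)" for \<beta>
      unfolding a u_def using L by (subst one_minus_mode) (simp_all add: S_def)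
    moreover have "((\<lambda>\<beta>. ?T \<beta> / (2 * \<Delta>) * (exp \<beta> / S \<beta>)) \<longlongrightarrow> (2 * \<Delta>) / (2 * \<Delta>) * 1) at_top"
      using \<Delta> leading_terms_asymp[OF L] by (intro tendsto_intros S) (auto simp: \<Delta>_def)
    ultimately show "((\<lambda>\<beta>. u \<beta> / ?a \<beta>) \<longlongrightarrow> 1) at_top" using \<Delta> by simp
  qed
  have "(?a \<longlongrightarrow> 0) at_top"
    using \<Delta> unfolding \<Delta>_def[symmetric] by real_asymp
  with l have "(l \<longlongrightarrow> 0) at_top"
    using tendsto_asymp_equiv_cong by blast
  then have "eventually (\<lambda>\<beta>. l \<beta> < 1) at_top"
    by (rule order_tendstoD) simp
  then have "eventually (\<lambda>\<beta>. ?\<gamma> \<beta> \<in> {l \<beta>..u \<beta>}) at_top"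
  proof eventually_elim
    case (elim \<beta>)
    let ?M = "mode_eigenvalue L 1 \<beta> ` {1..<L} \<union> Z"
    have fin: "finite ?M" using Z finite_subset by auto
    have "mode_eigenvalue L 1 \<beta> 1 \<in> ?M" using L by auto
    with fin have "mode_eigenvalue L 1 \<beta> 1 \<le> Max ?M" by (rule Max_ge)
    moreover have "x \<le> 1 - l \<beta>" if "x \<in> ?M" for x
    proof -
      from that Z consider k where "1 \<le> k" "k < L" "x = mode_eigenvalue L 1 \<beta> k" | "x = 0"
        by auto
      then show ?thesis
      proof cases
        case (1 k)
        then show ?thesis
          using one_minus_mode_ge[OF L 1(1,2), of \<beta>] unfolding l_def S_def \<Delta>_def by linarith
      next
        case 2
        with elim show ?thesis by simp
      qed
    qed
    then have "Max ?M \<le> 1 - l \<beta>"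
      using fin \<open>mode_eigenvalue L 1 \<beta> 1 \<in> ?M\<close> by (intro Max.boundedI) auto
    ultimately show ?case by (simp add: u_def)
  qed
  with l u show ?thesis by (rule asymp_equiv_sandwich_real)
qed

lemma mode_2: "mode_eigenvalue 2 1 \<beta> 1 = tanh \<beta>"
proof -
  have "{0..<2::int} = {0, 1}" by auto
  then show ?thesis
    by (simp add: mode_eigenvalue_def cos_transform_def kernel_weight_def angle_def tanh_altdef)
qed

theorem theorem5p3:
  fixes n L :: nat and m :: int and \<omega> :: real and \<gamma> :: "real \<Rightarrow> real"
  assumes n: "n \<ge> 2"
    and \<omega>: "\<omega> = 2 * pi * real_of_int m / real n"
    and L: "L = effective_period n m"
    and \<gamma>: "\<gamma> = (\<lambda>\<beta>. spectral_gap n \<omega> \<beta>)"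
  shows
    "(L = 1 \<longrightarrow>
        (\<forall>\<beta>\<ge>0. (\<exists>c. \<forall>i<n. \<forall>j<n. rot_kernel \<omega> \<beta> i j = c) \<and> \<gamma> \<beta> = 1)) \<and>
     (L = 2 \<longrightarrow>
        (\<forall>\<beta>\<ge>0. \<gamma> \<beta> = 1 - tanh \<beta> \<and>
               1 - tanh \<beta> = 2 * exp (- 2 * \<beta>) / (1 + exp (- 2 * \<beta>))) \<and>
        \<gamma> \<sim>[at_top] (\<lambda>\<beta>. 2 * exp (- 2 * \<beta>))) \<and>
     (L \<ge> 3 \<longrightarrow>
        (let \<Delta> = 1 - cos (2 * pi / real L)
         in \<gamma> \<sim>[at_top] (\<lambda>\<beta>. 2 * \<Delta> * exp (- \<beta> * \<Delta>))))"
proof -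
  define g where "g = nat (gcd m (int n))"
  have g: "g > 0" "int g = gcd m (int n)" using n by (simp_all add: g_def)
  have L_int: "int L = int n div int g"
    unfolding L effective_period_def g(2)[symmetric] by (simp flip: zdiv_int)
  have n_eq: "int n = int g * int L"
    unfolding L_int g(2) by simp
  then have "L > 0" using n by (auto intro: Nat.gr0I)
  have "int g dvd m"
    by (simp add: g(2))
  then obtain m' where m': "m = int g * m'" ..
  have "coprime (m div int g) (int n div int g)"
    unfolding g(2) using n by (intro div_gcd_coprime) auto
  then have coprime: "coprime m' (int L)"
    using g(1) by (simp add: m' L_int)
  define Z where "Z = (if g = 1 then {} else {0 :: real})"
  have \<gamma>_eq: "\<gamma> = (\<lambda>\<beta>. 1 - Max (mode_eigenvalue (int L) 1 \<beta> ` {1..<int L} \<union> Z))"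
  proof -
    have "mode_eigenvalue (int n) m \<beta> ` {1..<int n} = mode_eigenvalue (int L) 1 \<beta> ` {1..<int L} \<union> Z" for \<beta>
      unfolding n_eq m' Z_def using \<open>L > 0\<close> by (intro mode_image[OF g(1) _ coprime]) simp
    then show ?thesis
      by (simp only: \<gamma> spectral_gap_def \<omega> second_eigenvalue_attention[OF n])
  qed
  have one: "(\<exists>c. \<forall>i<n. \<forall>j<n. rot_kernel \<omega> \<beta> i j = c) \<and> \<gamma> \<beta> = 1" if "L = 1" for \<beta>
  proof
    have "\<omega> = 2 * pi * of_int m'"
    proof -
      have "real n = real_of_int (int n)" by simp
      also have "\<dots> = real g" unfolding n_eq that by simp
      finally show ?thesis using g(1) by (simp add: \<omega> m')
    qed
    then have "rot_kernel \<omega> \<beta> i j = exp (\<beta> * cos (2 * pi * of_int (m' * (int i - int j))))" for i j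
      by (simp add: rot_kernel_def mult.assoc)
    then show "\<exists>c. \<forall>i<n. \<forall>j<n. rot_kernel \<omega> \<beta> i j = c"
      unfolding cos_int_2pin by blast
    have "g \<noteq> 1" using n n_eq that by auto
    then show "\<gamma> \<beta> = 1" by (simp add: \<gamma>_eq that Z_def)
  qed
  have tanh: "1 - tanh \<beta> = 2 * exp (- 2 * \<beta>) / (1 + exp (- 2 * \<beta>))" for \<beta> :: real
  proof -
    have "1 + exp (- 2 * \<beta>) > 0" by (simp add: add_pos_pos)
    then show ?thesis unfolding tanh_real_altdef by (simp add: field_simps)
  qed
  have two: "\<gamma> \<beta> = 1 - tanh \<beta>" if "L = 2" "\<beta> \<ge> 0" for \<beta>
  proof -
    have "{1..<2::int} = {1}" by auto
    then have "\<gamma> \<beta> = 1 - Max (insert (tanh \<beta>) Z)"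
      by (simp add: \<gamma>_eq \<open>L = 2\<close> mode_2)
    then show ?thesis using \<open>\<beta> \<ge> 0\<close> by (simp add: Z_def)
  qed
  have two_asymp: "\<gamma> \<sim>[at_top] (\<lambda>\<beta>. 2 * exp (- 2 * \<beta>))" if "L = 2"
  proof -
    have "eventually (\<lambda>\<beta>. \<gamma> \<beta> = 2 * exp (- 2 * \<beta>) / (1 + exp (- 2 * \<beta>))) at_top"
      using eventually_ge_at_top[of 0] by eventually_elim (simp only: two that tanh)
    then have "\<gamma> \<sim>[at_top] (\<lambda>\<beta>. 2 * exp (- 2 * \<beta>) / (1 + exp (- 2 * \<beta>)))"
      by (rule asymp_equiv_refl_ev)
    also have "(\<lambda>\<beta>::real. 2 * exp (- 2 * \<beta>) / (1 + exp (- 2 * \<beta>))) \<sim>[at_top] (\<lambda>\<beta>. 2 * exp (- 2 * \<beta>))"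
      by real_asymp
    finally show ?thesis .
  qed
  have three: "\<gamma> \<sim>[at_top] (\<lambda>\<beta>. 2 * (1 - cos (2 * pi / real L)) * exp (- \<beta> * (1 - cos (2 * pi / real L))))"
    if "L \<ge> 3"
    using gap_asymp[of "int L" Z] that unfolding \<gamma>_eq by (simp add: angle_def Z_def)
  show ?thesis
    unfolding Let_def using one two tanh two_asymp three by blast
qed

end
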